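(* For any action of an inverse semigroup $S$ on a locally compact Hausdorff space $X$, the following are equivalent. (i) The transformation groupoid $S\ltimes X$ is Hausdorff. (ii) For any $s,t\in S$, the subset $\bigcup_{u\in s^\downarrow\cap t^\downarrow}X_{u^*u}$ is closed in $X_{s^*s}\cap X_{t^*t}$. (iii) For any $s\in S$, the subset $\bigcup_{e\in E(S)\cap s^\downarrow}X_e$ is closed in $X_{s^*s}$. If each $X_e$ ($e\in E(S)$) is compact, these conditions are equivalent to (ii)' For any $s,t\in S$, there exists a finite subset $F$ of $s^\downarrow\cap t^\downarrow$ such that $\bigcup_{v\in F}X_{v^*v}=\bigcup_{u\in s^\downarrow\cap t^\downarrow}X_{u^*u}$.
   Context: An inverse semigroup is a semigroup $S$ in which every $s$ has a unique $s^*$ with $ss^*s=s$, $s^*ss^*=s^*$; $E(S)$ is its commutative subsemigroup of idempotents; $s\le t$ means $ts^*s=s$; $t^\downarrow=\{s\in S\mid s\le t\}$. An action $\theta$ of $S$ on a topological space $X$ is a semigroup homomorphism $s\mapsto\theta_s$ from $S$ to the inverse semigroup of partial bijections of $X$ (bijections between subsets, composed on the largest possible domain) such that, writing $X_e$ for the subset on which $\theta_e$ ($e\in E(S)$) is the identity (so $\theta_s$ is a bijection $X_{s^*s}\to X_{ss^*}$): each $X_e$ is open, each $\theta_s\colon X_{s^*s}\to X_{ss^*}$ is continuous, and $\bigcup_{e\in E(S)}X_e=X$. Transformation groupoid: $S\ltimes X$ is the set of classes $[s,x]$ of pairs $(s,x)$, $x\in X_{s^*s}$, under $(s,x)\sim(t,y)$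 iff $x=y$ and $se=te$, $x\in X_e$ for some $e\in E(S)$; unit space $\{[e,x]\}\cong X$, $d([s,x])=x$, $r([s,x])=\theta_s(x)$, $[t,\theta_s(x)][s,x]=[ts,x]$, $[s,x]^{-1}=[s^*,\theta_s(x)]$; basis of open sets $[s,U]=\{[s,x]\mid x\in U\}$, $U\subset X_{s^*s}$ open. *)

theory Defs
  imports "HOL-Analysis.Analysis"
begin

class inverse_semigroup = semigroup_mult +
  assumes ex1_inverse: "\<exists>!t. s * t * s = s \<and> t * s * t = t"
begin

definition star :: "'a \<Rightarrow> 'a" where
  "star s = (THE t. s * t * s = s \<and> t * s * t = t)"

definition idems :: "'a set" where
  "idems = {e. e * e = e}"

definition le_isg :: "'a \<Rightarrow> 'a \<Rightarrow> bool" where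
  "le_isg s t \<longleftrightarrow> t * star s * s = s"

definition down :: "'a \<Rightarrow> 'a set" where
  "down t = {s. le_isg s t}"

lemma star_inverse: "s * star s * s = s" "star s * s * star s = star s"
  using theI'[OF ex1_inverse, of s] by (simp_all add: star_def)

lemma star_unique: "s * t * s = s \<Longrightarrow> t * s * t = t \<Longrightarrow> star s = t"
  using ex1_inverse[of s] star_inverse[of s] by blast

lemma star_mult_idem: "star s * s \<in> idems" "s * star s \<in> idems"
  using star_inverse[of s] by (simp_all add: idems_def mult.assoc[symmetric])

lemma idems_mult_closed:
  assumes "e \<in> idems" "f \<in> idems"
  shows "e * f \<in> idems"
proof -
  let ?x = "star (e * f)"
  have e: "e * e = e" "\<And>a. e * (e * a) = e * a" and f: "f * f = f" "\<And>a. f * (f * a) = f * a"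
    using assms by (simp_all add: idems_def flip: mult.assoc)
  have i: "e * (f * (?x * (e * f))) = e * f" "?x * (e * (f * ?x)) = ?x"
      "\<And>a. ?x * (e * (f * (?x * a))) = ?x * a"
    using star_inverse[of "e * f"] by (simp_all add: mult.assoc) (metis mult.assoc)
  have "?x = f * ?x * e"
    by (rule star_unique) (simp_all add: mult.assoc e f i)
  then have "?x * ?x = f * ?x * e * (f * ?x * e)" by simp
  also have "\<dots> = f * ?x * e" by (simp add: mult.assoc i)
  finally have xx: "?x * ?x = ?x" using \<open>?x = f * ?x * e\<close> by simp
  then have "star ?x = ?x" by (intro star_unique) simp_all
  moreover have "star ?x = e * f"
    by (rule star_unique) (simp_all add: star_inverse)
  ultimately show ?thesis using xx by (simp add: idems_def)
qed

lemma idems_commute: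
  assumes "e \<in> idems" "f \<in> idems"
  shows "e * f = f * e"
proof -
  have e: "e * e = e" "\<And>a. e * (e * a) = e * a" and f: "f * f = f" "\<And>a. f * (f * a) = f * a"
    using assms by (simp_all add: idems_def flip: mult.assoc)
  have ef: "e * (f * (e * f)) = e * f" and fe: "f * (e * (f * e)) = f * e"
    using idems_mult_closed[OF assms] idems_mult_closed[OF assms(2,1)]
    by (simp_all add: idems_def mult.assoc)
  have "star (e * f) = e * f" "star (e * f) = f * e"
    by (rule star_unique; simp add: mult.assoc e f ef fe)+
  then show ?thesis by simp
qed

end

text \<open>Partial bijections of \<open>X\<close> are partial functions \<open>'x \<rightharpoonup> 'x\<close>; their composition on the
  largest possible domain is \<open>\<circ>\<^sub>m\<close>.\<close>

definition partial_bij :: "'x set \<Rightarrow> ('x \<rightharpoonup> 'x) \<Rightarrow> bool" where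
  "partial_bij X f \<longleftrightarrow> dom f \<subseteq> X \<and> ran f \<subseteq> X \<and> inj_on f (dom f)"

definition fixed_set :: "('s \<Rightarrow> 'x \<rightharpoonup> 'x) \<Rightarrow> 's \<Rightarrow> 'x set" where
  "fixed_set \<theta> e = {x. \<theta> e x = Some x}"

locale inverse_semigroup_action =
  fixes X :: "'x topology" and \<theta> :: "'s::inverse_semigroup \<Rightarrow> 'x \<rightharpoonup> 'x"
  assumes partial_bij: "partial_bij (topspace X) (\<theta> s)"
    and hom: "\<theta> (s * t) = \<theta> s \<circ>\<^sub>m \<theta> t"
    and open_fixed_set: "e \<in> idems \<Longrightarrow> openin X (fixed_set \<theta> e)"
    and continuous: "continuous_map (subtopology X (fixed_set \<theta> (star s * s)))
          (subtopology X (fixed_set \<theta> (s * star s))) (\<lambda>x. the (\<theta> s x))"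
    and cover: "(\<Union>e\<in>idems. fixed_set \<theta> e) = topspace X"

definition germ_pairs :: "('s::inverse_semigroup \<Rightarrow> 'x \<rightharpoonup> 'x) \<Rightarrow> ('s \<times> 'x) set" where
  "germ_pairs \<theta> = {(s, x). x \<in> fixed_set \<theta> (star s * s)}"

definition germ_rel :: "('s::inverse_semigroup \<Rightarrow> 'x \<rightharpoonup> 'x) \<Rightarrow> (('s \<times> 'x) \<times> ('s \<times> 'x)) set" where
  "germ_rel \<theta> = {((s, x), (t, y)). (s, x) \<in> germ_pairs \<theta> \<and> (t, y) \<in> germ_pairs \<theta> \<and>
     x = y \<and> (\<exists>e\<in>idems. s * e = t * e \<and> x \<in> fixed_set \<theta> e)}"

text \<open>\<open>germ \<theta> s x\<close> is the class \<open>[s, x]\<close>; it is meaningful only for \<open>x \<in> fixed_set \<theta> (star s * s)\<close>.\<close>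

definition germ :: "('s::inverse_semigroup \<Rightarrow> 'x \<rightharpoonup> 'x) \<Rightarrow> 's \<Rightarrow> 'x \<Rightarrow> ('s \<times> 'x) set" where
  "germ \<theta> s x = germ_rel \<theta> `` {(s, x)}"

definition germ_basis :: "'x topology \<Rightarrow> ('s::inverse_semigroup \<Rightarrow> 'x \<rightharpoonup> 'x) \<Rightarrow> ('s \<times> 'x) set set set" where
  "germ_basis X \<theta> = {germ \<theta> s ` U | s U. openin X U \<and> U \<subseteq> fixed_set \<theta> (star s * s)}"

text \<open>The transformation groupoid \<open>S \<ltimes> X\<close> as the topological space of its arrows. Being Hausdorff
  is a property of this space and does not involve the groupoid operations.\<close>

definition transformation_groupoid ::
    "'x topology \<Rightarrow> ('s::inverse_semigroup \<Rightarrow> 'x \<rightharpoonup> 'x) \<Rightarrow> ('s \<times> 'x) set topology" where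
  "transformation_groupoid X \<theta> = topology_generated_by (germ_basis X \<theta>)"

context inverse_semigroup_action
begin

lemma dom_eq: "dom (\<theta> s) = fixed_set \<theta> (star s * s)"
proof -
  have sub: "x \<in> fixed_set \<theta> (star s * s)" if sx: "\<theta> s x = Some y" for x y
  proof -
    have "\<theta> (s * (star s * s)) x = Some y"
      using sx star_inverse(1)[of s] by (simp add: mult.assoc)
    then obtain z where z: "\<theta> (star s * s) x = Some z" "\<theta> s z = Some y"
      unfolding hom[of s "star s * s"] by (auto simp: map_comp_Some_iff)
    moreover have "z = x"
      using partial_bij[of s] z(2) sx unfolding partial_bij_def inj_on_def by (metis domI)
    ultimately show ?thesis by (simp add: fixed_set_def)
  qed
  have "x \<in> dom (\<theta> s)" if "x \<in> fixed_set \<theta> (star s * s)" for x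
    using that by (auto simp: fixed_set_def hom map_comp_Some_iff)
  with sub show ?thesis by blast
qed

lemma ran_eq: "ran (\<theta> s) = fixed_set \<theta> (s * star s)"
proof -
  have "y \<in> fixed_set \<theta> (s * star s)" if sx: "\<theta> s x = Some y" for x y
  proof -
    have "\<theta> (star s * s) x = Some x"
      using dom_eq[of s] sx by (auto simp: fixed_set_def)
    then show ?thesis
      using sx by (simp add: fixed_set_def hom map_comp_Some_iff)
  qed
  moreover have "y \<in> ran (\<theta> s)" if "y \<in> fixed_set \<theta> (s * star s)" for y
    using that by (auto simp: fixed_set_def hom map_comp_Some_iff ran_def)
  ultimately show ?thesis by (auto simp: ran_def)
qed

lemma equiv_germ_rel: "equiv (germ_pairs \<theta>) (germ_rel \<theta>)"
proof (rule equivI)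
  show "germ_rel \<theta> \<subseteq> germ_pairs \<theta> \<times> germ_pairs \<theta>"
    by (auto simp: germ_rel_def)
  show "refl_on (germ_pairs \<theta>) (germ_rel \<theta>)"
    by (auto simp: refl_on_def germ_rel_def germ_pairs_def intro!: bexI star_mult_idem)
  show "sym (germ_rel \<theta>)"
    by (auto simp: sym_def germ_rel_def; metis)
  show "trans (germ_rel \<theta>)"
  proof (rule transI, clarsimp simp: germ_rel_def)
    fix s t u e f x
    assume *: "e \<in> idems" "f \<in> idems" "s * e = t * e" "t * f = u * f"
      "x \<in> fixed_set \<theta> e" "x \<in> fixed_set \<theta> f"
    have "s * (e * f) = t * (f * e)"
      using * idems_commute[of e f] by (metis mult.assoc)
    also have "\<dots> = u * (e * f)"
      using * idems_commute[of e f] by (metis mult.assoc)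
    finally have "s * (e * f) = u * (e * f)" .
    moreover have "x \<in> fixed_set \<theta> (e * f)"
      using * by (simp add: fixed_set_def hom)
    ultimately show "\<exists>e\<in>idems. s * e = u * e \<and> x \<in> fixed_set \<theta> e"
      using * idems_mult_closed by blast
  qed
qed

lemma germ_eq_iff:
  assumes "x \<in> fixed_set \<theta> (star s * s)" "y \<in> fixed_set \<theta> (star t * t)"
  shows "germ \<theta> s x = germ \<theta> t y \<longleftrightarrow> x = y \<and> (\<exists>e\<in>idems. s * e = t * e \<and> x \<in> fixed_set \<theta> e)"
  using eq_equiv_class_iff[OF equiv_germ_rel, of "(s, x)" "(t, y)"] assms
  by (auto simp: germ_def germ_rel_def germ_pairs_def)

text \<open>The sets \<open>[s, U]\<close> are a basis, not just a subbasis, of the generated topology, and the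
  underlying set of the space consists of all classes.\<close>

lemma openin_transformation_groupoid:
  "openin (transformation_groupoid X \<theta>) W \<longleftrightarrow> (\<exists>\<B>\<subseteq>germ_basis X \<theta>. W = \<Union>\<B>)"
proof -
  have inter: "(arbitrary union_of (\<lambda>B. B \<in> germ_basis X \<theta>)) (A \<inter> B)"
    if AB: "A \<in> germ_basis X \<theta>" "B \<in> germ_basis X \<theta>" for A B
  proof -
    obtain s U t V where A: "A = germ \<theta> s ` U" "openin X U" "U \<subseteq> fixed_set \<theta> (star s * s)"
      and B: "B = germ \<theta> t ` V" "openin X V" "V \<subseteq> fixed_set \<theta> (star t * t)"
      using AB by (auto simp: germ_basis_def)
    have "\<exists>C\<in>germ_basis X \<theta>. g \<in> C \<and> C \<subseteq> A \<inter> B" if g: "g \<in> A \<inter> B" for g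
    proof -
      obtain x y where xy: "x \<in> U" "y \<in> V" "g = germ \<theta> s x" "germ \<theta> s x = germ \<theta> t y"
        using g A B by auto
      then obtain e where e: "e \<in> idems" "s * e = t * e" "x \<in> fixed_set \<theta> e" and "x = y"
        using germ_eq_iff[of x s y t] A B by auto
      let ?W = "U \<inter> V \<inter> fixed_set \<theta> e"
      have eq: "germ \<theta> s z = germ \<theta> t z" if "z \<in> ?W" for z
        using germ_eq_iff[of z s z t] A B e that by blast
      have "germ \<theta> s ` ?W \<subseteq> A \<inter> B"
      proof (rule image_subsetI)
        fix z assume z: "z \<in> ?W"
        then have "germ \<theta> s z \<in> A" "germ \<theta> t z \<in> B" by (simp_all add: A(1) B(1))
        then show "germ \<theta> s z \<in> A \<inter> B" using eq[OF z] by simp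
      qed
      moreover have "germ \<theta> s ` ?W \<in> germ_basis X \<theta>"
        unfolding germ_basis_def mem_Collect_eq
        using A(2,3) B(2) open_fixed_set[OF e(1)] by (intro exI[of _ s] exI[of _ ?W]) auto
      moreover have "g \<in> germ \<theta> s ` ?W" unfolding xy(3) using xy(1,2) \<open>x = y\<close> e(3) by blast
      ultimately show ?thesis by (intro bexI[of _ "germ \<theta> s ` ?W"] conjI)
    qed
    then show ?thesis
      unfolding arbitrary_union_of_alt by blast
  qed
  have top: "istopology (arbitrary union_of (\<lambda>B. B \<in> germ_basis X \<theta>))"
    unfolding istopology_base_eq using inter by blast
  have "openin (transformation_groupoid X \<theta>) W \<longleftrightarrow>
      (arbitrary union_of (\<lambda>B. B \<in> germ_basis X \<theta>)) W"
  proof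
    assume "openin (transformation_groupoid X \<theta>) W"
    then have "generate_topology_on (germ_basis X \<theta>) W"
      by (simp add: transformation_groupoid_def openin_topology_generated_by_iff)
    then show "(arbitrary union_of (\<lambda>B. B \<in> germ_basis X \<theta>)) W"
    proof induction
      case Empty
      then show ?case by simp
    next
      case (Int a b)
      then show ?case using top by (auto simp: istopology_def)
    next
      case (UN K)
      then show ?case using top by (auto simp: istopology_def)
    next
      case (Basis s)
      then show ?case by (simp add: arbitrary_union_of_inc)
    qed
  next
    assume "(arbitrary union_of (\<lambda>B. B \<in> germ_basis X \<theta>)) W"
    then show "openin (transformation_groupoid X \<theta>) W"
      unfolding union_of_def transformation_groupoid_def
      by (clarify, intro openin_Union topology_generated_by_Basis) auto
  qed
  also have "\<dots> \<longleftrightarrow> (\<exists>\<B>\<subseteq>germ_basis X \<theta>. W = \<Union>\<B>)"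
    by (auto simp: union_of_def arbitrary_def)
  finally show ?thesis .
qed

lemma topspace_transformation_groupoid:
  "topspace (transformation_groupoid X \<theta>) = germ_pairs \<theta> // germ_rel \<theta>"
proof -
  have "germ \<theta> s x \<in> \<Union>(germ_basis X \<theta>)" if "x \<in> fixed_set \<theta> (star s * s)" for s x
    using that open_fixed_set[OF star_mult_idem(1), of s] by (auto simp: germ_basis_def)
  then have "\<Union>(germ_basis X \<theta>) = germ_pairs \<theta> // germ_rel \<theta>"
    by (fastforce simp: germ_basis_def germ_def germ_pairs_def quotient_def)
  then show ?thesis
    by (simp add: transformation_groupoid_def topology_generated_by_topspace)
qed

end

end

theory Submission
  imports Defs
begin

text \<open>
  Two elements \<open>s\<close> and \<open>t\<close> define the same germ at a point \<open>x\<close> of both domains exactly when \<open>x\<close>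
  lies in the domain of a common lower bound of \<open>s\<close> and \<open>t\<close> (lemma
  \<open>germ_eq_iff_common_lower_bound\<close>). So the union of the sets \<open>X\<^bsub>u\<^sup>*u\<^esub>\<close> over \<open>u \<le> s, t\<close> is the
  equalizer of the two sections \<open>x \<mapsto> [s,x]\<close> and \<open>x \<mapsto> [t,x]\<close> on \<open>X\<^bsub>s\<^sup>*s\<^esub> \<inter> X\<^bsub>t\<^sup>*t\<^esub>\<close>. Sections are
  continuous and the groupoid is covered by their images, which are open. If the groupoid is
  Hausdorff, equalizers are closed. Conversely, germs at different points are separated by
  separating the points in \<open>X\<close>, and different germs \<open>[s,x]\<close>, \<open>[t,x]\<close> at the same point are
  separated by the images under the two sections of the complement of their equalizer, which is
  open when the equalizer is closed.

  The idempotents below \<open>s\<close> are the common lower bounds of \<open>s\<close> and \<open>s\<^sup>*s\<close>, so the condition on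
  idempotents is the closedness of particular equalizers. In the other direction, the germs of \<open>s\<close>
  and \<open>t\<close> at \<open>x\<close> agree if and only if \<open>\<theta>\<^sub>s(x) = \<theta>\<^sub>t(x)\<close> and \<open>s\<^sup>*t\<close> has an idempotent below it whose
  domain contains \<open>x\<close>: the product \<open>[s,x]\<^sup>-\<^sup>1[t,x]\<close> is then a unit. The first of these two conditions
  is closed because \<open>X\<close> is Hausdorff, and it forces \<open>x\<close> into the domain of \<open>s\<^sup>*t\<close>, where the second
  is closed by the condition on idempotents.

  Finally, the domains \<open>X\<^bsub>u\<^sup>*u\<^esub>\<close> are open, so when they are also compact, a union of them inside
  the compact set \<open>X\<^bsub>s\<^sup>*s\<^esub> \<inter> X\<^bsub>t\<^sup>*t\<^esub>\<close> is closed if and only if finitely many of them suffice.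
\<close>

section \<open>The natural order of an inverse semigroup\<close>

lemma idems_absorb:
  assumes "e \<in> idems"
  shows "e * e = e" "e * (e * a) = e * a"
  using assms by (simp_all add: idems_def flip: mult.assoc)

lemma star_idem:
  assumes "e \<in> idems"
  shows "star e = e"
  using assms by (intro star_unique) (simp_all add: idems_def)

lemma star_mult: "star (s * t) = star t * star s" for s t :: "'s::inverse_semigroup"
proof (rule star_unique)
  have comm: "(t * star t) * (star s * s) = (star s * s) * (t * star t)"
    by (intro idems_commute star_mult_idem)
  have "s * t * (star t * star s) * (s * t) = s * ((t * star t) * (star s * s)) * t"
    by (simp add: mult.assoc)
  also have "\<dots> = (s * star s * s) * (t * star t * t)"
    unfolding comm by (simp add: mult.assoc)
  finally show "s * t * (star t * star s) * (s * t) = s * t"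
    by (simp add: star_inverse)
  have "star t * star s * (s * t) * (star t * star s)
      = star t * ((star s * s) * (t * star t)) * star s"
    by (simp add: mult.assoc)
  also have "\<dots> = (star t * t * star t) * (star s * s * star s)"
    unfolding comm[symmetric] by (simp add: mult.assoc)
  finally show "star t * star s * (s * t) * (star t * star s) = star t * star s"
    by (simp add: star_inverse)
qed

lemma mult_idem_in_down:
  assumes "e \<in> idems"
  shows "s * e \<in> down s"
proof -
  have "s * star (s * e) * (s * e) = s * (e * (star s * s)) * e"
    by (simp add: star_mult star_idem[OF assms] mult.assoc)
  also have "\<dots> = (s * star s * s) * (e * e)"
    unfolding idems_commute[OF assms star_mult_idem(1)] by (simp add: mult.assoc)
  also have "\<dots> = s * e"
    using assms by (simp add: star_inverse idems_absorb)
  finally show ?thesis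
    by (simp add: down_def le_isg_def)
qed

lemma in_downD: "u \<in> down s \<Longrightarrow> s * (star u * u) = u"
  by (simp add: down_def le_isg_def mult.assoc)

lemma idem_in_down_iff:
  assumes "e \<in> idems"
  shows "e \<in> down s \<longleftrightarrow> s * e = e"
  using assms by (simp add: down_def le_isg_def star_idem mult.assoc idems_absorb)

lemma idems_Int_down: "idems \<inter> down s = down s \<inter> down (star s * s)"
proof (intro equalityI subsetI)
  fix e assume e: "e \<in> idems \<inter> down s"
  then have se: "s * e = e" using idem_in_down_iff by blast
  then have "star (s * e) = star e" by simp
  then have es: "e * star s = e" using e by (simp add: star_mult star_idem)
  have "(star s * s) * e = (star s * s) * (e * e)" using e by (simp add: idems_absorb)
  also have "\<dots> = e * star s * (s * e)"
    using idems_commute[OF star_mult_idem(1), of e s] e by (metis IntD1 mult.assoc)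
  also have "\<dots> = e" using e by (simp add: es se idems_absorb)
  finally show "e \<in> down s \<inter> down (star s * s)"
    using e idem_in_down_iff by blast
next
  fix u assume u: "u \<in> down s \<inter> down (star s * s)"
  then have "u = (star s * s) * (star u * u)" by (metis IntD2 in_downD)
  then have "u \<in> idems" by (metis idems_mult_closed star_mult_idem(1))
  with u show "u \<in> idems \<inter> down s" by simp
qed

section \<open>Equality of germs\<close>

context inverse_semigroup_action
begin

abbreviation source :: "'s \<Rightarrow> 'x set" where
  "source s \<equiv> fixed_set \<theta> (star s * s)"

abbreviation common_source :: "'s \<Rightarrow> 's \<Rightarrow> 'x set" where
  "common_source s t \<equiv> (\<Union>u\<in>down s \<inter> down t. source u)"

lemma source_iff: "x \<in> source s \<longleftrightarrow> (\<exists>y. \<theta> s x = Some y)"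
  using dom_eq[of s] by blast

lemma source_idem: "e \<in> idems \<Longrightarrow> source e = fixed_set \<theta> e"
  by (simp add: star_idem idems_absorb)

lemma openin_source: "openin X (source s)"
  by (intro open_fixed_set star_mult_idem)

lemma source_subset_topspace: "source s \<subseteq> topspace X"
  by (intro openin_subset openin_source)

lemma fixed_set_mult:
  assumes "x \<in> fixed_set \<theta> e" "x \<in> fixed_set \<theta> f"
  shows "x \<in> fixed_set \<theta> (e * f)"
  using assms by (simp add: fixed_set_def hom)

lemma apply_mult_fixed:
  assumes "x \<in> fixed_set \<theta> e"
  shows "\<theta> (s * e) x = \<theta> s x"
  using assms by (simp add: fixed_set_def hom)

lemma source_mono:
  assumes "u \<in> down s"
  shows "source u \<subseteq> source s"
proof
  fix x assume x: "x \<in> source u"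
  then have "\<theta> u x = \<theta> s x"
    using apply_mult_fixed[of x "star u * u" s] in_downD[OF assms] by simp
  with x show "x \<in> source s" by (simp only: source_iff)
qed

lemma common_source_subset: "common_source s t \<subseteq> source s \<inter> source t"
  using source_mono by blast

text \<open>If \<open>se = te\<close> witnesses that two germs agree, then \<open>se\<close> is a common lower bound; and a common
  lower bound \<open>u\<close> gives the witness \<open>u\<^sup>*u\<close>.\<close>

lemma germ_eq_iff_common_lower_bound:
  assumes "x \<in> source s" "x \<in> source t"
  shows "germ \<theta> s x = germ \<theta> t x \<longleftrightarrow> x \<in> common_source s t"
proof -
  have "x \<in> common_source s t"
    if e: "e \<in> idems" "s * e = t * e" "x \<in> fixed_set \<theta> e" for e
  proof -
    have "s * e \<in> down s \<inter> down t"
      using mult_idem_in_down[OF e(1)] e(2) by (metis IntI)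
    moreover have "x \<in> source (s * e)"
      using assms(1) apply_mult_fixed[OF e(3)] by (simp only: source_iff)
    ultimately show ?thesis by blast
  qed
  moreover have "\<exists>e\<in>idems. s * e = t * e \<and> x \<in> fixed_set \<theta> e" if "x \<in> common_source s t"
  proof -
    from that obtain u where u: "u \<in> down s" "u \<in> down t" "x \<in> source u" by blast
    then show ?thesis
      using in_downD[OF u(1)] in_downD[OF u(2)] star_mult_idem(1)[of u] by metis
  qed
  ultimately show ?thesis
    using germ_eq_iff[OF assms] by blast
qed

lemma idems_below_eq_common_source:
  "(\<Union>e\<in>idems \<inter> down s. fixed_set \<theta> e) = common_source s (star s * s)"
  unfolding idems_Int_down[symmetric] using source_idem by auto

lemma source_star_mult: "source (star s * s) = source s"
  by (intro source_idem star_mult_idem)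

lemma source_star_mult_of_eq:
  assumes "x \<in> source s" "\<theta> s x = \<theta> t x"
  shows "x \<in> source (star s * t)"
proof -
  have "\<theta> (star s * t) x = \<theta> (star s * s) x"
    using assms(2) by (simp add: hom map_comp_def)
  also have "\<dots> = Some x"
    using assms(1) by (simp add: fixed_set_def)
  finally show ?thesis
    unfolding source_iff by blast
qed

text \<open>The groupoid identity \<open>[t,x] = [s,x][s\<^sup>*t,x]\<close>, read at the level of domains: when \<open>s\<close> and \<open>t\<close> send
  \<open>x\<close> to the same point, their germs agree if and only if \<open>[s\<^sup>*t,x]\<close> is a unit.\<close>

lemma common_source_eq_idems_below:
  "common_source s t = {x \<in> source s \<inter> source t. \<theta> s x = \<theta> t x} \<inter>
     (\<Union>e\<in>idems \<inter> down (star s * t). fixed_set \<theta> e)"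
proof (intro equalityI subsetI)
  fix x assume x: "x \<in> common_source s t"
  then obtain u where u: "u \<in> down s" "u \<in> down t" "x \<in> source u" by blast
  define p where "p = star u * u"
  have p: "p \<in> idems" "s * p = u" "t * p = u" "x \<in> fixed_set \<theta> p"
    using u star_mult_idem(1)[of u] in_downD by (auto simp: p_def)
  have st: "x \<in> source s" "x \<in> source t" using x common_source_subset by blast+
  have eq: "\<theta> s x = \<theta> t x"
    using apply_mult_fixed[OF p(4), of s] apply_mult_fixed[OF p(4), of t] p(2,3) by simp
  have "p = star (s * p) * (s * p)" unfolding p(2) by (rule p_def)
  also have "\<dots> = p * (star s * s) * p"
    using p(1) by (simp add: star_mult star_idem mult.assoc)
  also have "\<dots> = (star s * s) * (p * p)"
    unfolding idems_commute[OF p(1) star_mult_idem(1)] by (simp add: mult.assoc)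
  also have "\<dots> = star s * (t * p)"
    unfolding idems_absorb(1)[OF p(1)] p(3) p(2)[symmetric] by (simp add: mult.assoc)
  finally have "star s * t * p = p" by (simp add: mult.assoc)
  then have "p \<in> down (star s * t)" using p(1) by (simp add: idem_in_down_iff)
  then show "x \<in> {x \<in> source s \<inter> source t. \<theta> s x = \<theta> t x} \<inter>
     (\<Union>e\<in>idems \<inter> down (star s * t). fixed_set \<theta> e)"
    using p st eq by blast
next
  fix x assume "x \<in> {x \<in> source s \<inter> source t. \<theta> s x = \<theta> t x} \<inter>
     (\<Union>e\<in>idems \<inter> down (star s * t). fixed_set \<theta> e)"
  then obtain e where st: "x \<in> source s" "x \<in> source t" and eq: "\<theta> s x = \<theta> t x"
    and e: "e \<in> idems" "star s * t * e = e" "x \<in> fixed_set \<theta> e"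
    using idem_in_down_iff by blast
  \<comment> \<open>From \<open>e = s\<^sup>*te\<close> follows only \<open>se = ss\<^sup>*te\<close>. The projection \<open>ss\<^sup>*\<close> can be moved
    past \<open>t\<close>, where it becomes the domain projection \<open>f\<close> of \<open>s\<^sup>*t\<close>; and \<open>f\<close> fixes \<open>x\<close> because
    \<open>\<theta>\<^sub>t(x) = \<theta>\<^sub>s(x)\<close> lies in the range of \<open>\<theta>\<^sub>s\<close>.\<close>
  define f where "f = star (star s * t) * (star s * t)"
  have f: "f \<in> idems" unfolding f_def by (rule star_mult_idem)
  have xf: "x \<in> fixed_set \<theta> f"
    unfolding f_def by (rule source_star_mult_of_eq[OF st(1) eq])
  have "f = star t * (star (star s) * star s * t)"
    unfolding f_def by (simp add: star_mult mult.assoc)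
  moreover have "star (star s) = s"
    by (rule star_unique) (simp_all add: star_inverse)
  ultimately have "t * f = (t * star t) * (s * star s) * t" by (simp add: mult.assoc)
  also have "\<dots> = (s * star s) * (t * star t) * t"
    using idems_commute[OF star_mult_idem(2) star_mult_idem(2)] by metis
  also have "\<dots> = s * star s * t"
    by (metis mult.assoc star_inverse(1))
  finally have tf: "s * star s * t = t * f" by simp
  have "s * (e * f) = s * (star s * t * e) * f" unfolding e(2) by (simp add: mult.assoc)
  also have "\<dots> = (s * star s * t) * (e * f)" by (simp add: mult.assoc)
  also have "\<dots> = t * (f * (e * f))" unfolding tf by (simp add: mult.assoc)
  also have "f * (e * f) = e * f"
    using idems_commute[OF e(1) f] idems_absorb[OF f] by simp
  finally have "s * (e * f) = t * (e * f)" .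
  moreover have "e * f \<in> idems" by (intro idems_mult_closed e f)
  moreover have "x \<in> fixed_set \<theta> (e * f)" by (intro fixed_set_mult e xf)
  ultimately have "germ \<theta> s x = germ \<theta> t x" using germ_eq_iff[OF st] by blast
  then show "x \<in> common_source s t" using germ_eq_iff_common_lower_bound[OF st] by blast
qed

section \<open>The Hausdorff property and closed equalizers\<close>

lemma openin_germ_image:
  assumes "openin X U" "U \<subseteq> source s"
  shows "openin (transformation_groupoid X \<theta>) (germ \<theta> s ` U)"
  unfolding openin_transformation_groupoid
  using assms by (intro exI[of _ "{germ \<theta> s ` U}"]) (auto simp: germ_basis_def)

lemma in_topspace_iff_germ:
  "g \<in> topspace (transformation_groupoid X \<theta>) \<longleftrightarrow> (\<exists>s x. x \<in> source s \<and> g = germ \<theta> s x)"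
  unfolding topspace_transformation_groupoid
  by (auto simp: quotient_def germ_def germ_pairs_def)

text \<open>Near a point where the section \<open>[s,\<cdot>]\<close> meets a basic open set \<open>[t,V]\<close>, it coincides with the
  section \<open>[t,\<cdot>]\<close>, because a witness for the equality of two germs works on an open set.\<close>

lemma continuous_map_germ:
  "continuous_map (subtopology X (source s)) (transformation_groupoid X \<theta>) (germ \<theta> s)"
proof -
  have basic: "openin X {x \<in> source s. germ \<theta> s x \<in> B}" if B: "B \<in> germ_basis X \<theta>" for B
  proof (subst openin_subopen, safe)
    fix x assume x: "x \<in> source s" "germ \<theta> s x \<in> B"
    obtain t V where V: "B = germ \<theta> t ` V" "openin X V" "V \<subseteq> source t"
      using B by (auto simp: germ_basis_def)
    obtain y where y: "y \<in> V" "germ \<theta> s x = germ \<theta> t y" using x V by blast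
    then obtain e where e: "e \<in> idems" "s * e = t * e" "x \<in> fixed_set \<theta> e" and [simp]: "y = x"
      using germ_eq_iff[of x s y t] x(1) V(3) by blast
    let ?W = "source s \<inter> V \<inter> fixed_set \<theta> e"
    have "germ \<theta> s z = germ \<theta> t z" if "z \<in> ?W" for z
      using germ_eq_iff[of z s z t] V(3) e that by blast
    then have "?W \<subseteq> {x \<in> source s. germ \<theta> s x \<in> B}"
      using V(1) by auto
    moreover have "openin X ?W"
      by (intro openin_Int openin_source V open_fixed_set e)
    ultimately show "\<exists>T. openin X T \<and> x \<in> T \<and> T \<subseteq> {x \<in> source s. germ \<theta> s x \<in> B}"
      using x(1) y(1) e(3) by (intro exI[of _ ?W]) auto
  qed
  have "openin (subtopology X (source s)) {x \<in> source s. germ \<theta> s x \<in> W}"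
    if W: "openin (transformation_groupoid X \<theta>) W" for W
  proof -
    obtain \<B> where \<B>: "\<B> \<subseteq> germ_basis X \<theta>" "W = \<Union>\<B>"
      using W unfolding openin_transformation_groupoid by blast
    have "{x \<in> source s. germ \<theta> s x \<in> W} = (\<Union>B\<in>\<B>. {x \<in> source s. germ \<theta> s x \<in> B})"
      using \<B>(2) by blast
    moreover have "openin X \<dots>" using basic \<B>(1) by (intro openin_clauses(3)) blast
    ultimately have "openin X {x \<in> source s. germ \<theta> s x \<in> W}" by simp
    then show ?thesis
      by (simp add: openin_open_subtopology[OF openin_source] subset_iff)
  qed
  moreover have "germ \<theta> s x \<in> topspace (transformation_groupoid X \<theta>)" if "x \<in> source s" for x
    using that in_topspace_iff_germ by blast
  moreover have "topspace (subtopology X (source s)) = source s"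
    using source_subset_topspace by (rule topspace_subtopology_subset)
  ultimately show ?thesis
    unfolding continuous_map_def by simp
qed

lemma closedin_common_source:
  assumes "Hausdorff_space (transformation_groupoid X \<theta>)"
  shows "closedin (subtopology X (source s \<inter> source t)) (common_source s t)"
proof -
  let ?D = "source s \<inter> source t"
  have top: "topspace (subtopology X ?D) = ?D"
    using source_subset_topspace[of s] by (intro topspace_subtopology_subset) blast
  have "closedin (subtopology X ?D) {x \<in> topspace (subtopology X ?D). germ \<theta> s x = germ \<theta> t x}"
    by (intro closedin_continuous_maps_eq[OF assms]
        continuous_map_from_subtopology_mono[OF continuous_map_germ]) auto
  moreover have "{x \<in> ?D. germ \<theta> s x = germ \<theta> t x} = common_source s t"
    using germ_eq_iff_common_lower_bound common_source_subset by blast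
  ultimately show ?thesis by (simp only: top)
qed

lemma Hausdorff_space_transformation_groupoid:
  assumes X: "Hausdorff_space X"
    and closed: "\<And>s t. closedin (subtopology X (source s \<inter> source t)) (common_source s t)"
  shows "Hausdorff_space (transformation_groupoid X \<theta>)"
  unfolding Hausdorff_space_def
proof (intro allI impI)
  fix g h
  assume gh: "g \<in> topspace (transformation_groupoid X \<theta>) \<and>
    h \<in> topspace (transformation_groupoid X \<theta>) \<and> g \<noteq> h"
  then obtain s x t y where g: "x \<in> source s" "g = germ \<theta> s x"
    and h: "y \<in> source t" "h = germ \<theta> t y"
    unfolding in_topspace_iff_germ by blast
  have "\<exists>U V. openin X U \<and> openin X V \<and> U \<subseteq> source s \<and> V \<subseteq> source t \<and> x \<in> U \<and> y \<in> V \<and>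
      (\<forall>z\<in>U \<inter> V. germ \<theta> s z \<noteq> germ \<theta> t z)"
  proof (cases "x = y")
    case False
    moreover have "x \<in> topspace X" "y \<in> topspace X"
      using g h source_subset_topspace by blast+
    ultimately obtain U V where "openin X U" "openin X V" "x \<in> U" "y \<in> V" "disjnt U V"
      using X unfolding Hausdorff_space_def by metis
    then show ?thesis
      using g(1) h(1) by (intro exI[of _ "U \<inter> source s"] exI[of _ "V \<inter> source t"])
        (auto simp: disjnt_iff intro!: openin_Int openin_source)
  next
    case True
    let ?D = "source s \<inter> source t"
    let ?O = "?D - common_source s t"
    have D: "openin X ?D" by (intro openin_Int openin_source)
    then have top: "topspace (subtopology X ?D) = ?D"
      by (intro topspace_subtopology_subset openin_subset)
    have "openin (subtopology X ?D) ?O"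
      using openin_diff[OF openin_topspace closed[of s t]] by (simp only: top)
    then have O: "openin X ?O"
      unfolding openin_open_subtopology[OF D] by (rule conjunct1)
    have ne: "\<forall>z\<in>?O \<inter> ?O. germ \<theta> s z \<noteq> germ \<theta> t z"
    proof
      fix z assume "z \<in> ?O \<inter> ?O"
      then have z: "z \<in> ?D" "z \<notin> common_source s t"
        by (rule DiffD1[OF IntD1], elim IntE DiffE)
      show "germ \<theta> s z \<noteq> germ \<theta> t z"
        unfolding germ_eq_iff_common_lower_bound[OF IntD1[OF z(1)] IntD2[OF z(1)]] by (rule z(2))
    qed
    have st: "x \<in> source s" "x \<in> source t" using g(1) h(1) True by simp_all
    have "germ \<theta> s x \<noteq> germ \<theta> t x" using gh g(2) h(2) True by simp
    then have x: "x \<in> ?O"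
      unfolding germ_eq_iff_common_lower_bound[OF st] using st by (intro DiffI IntI)
    show ?thesis
      by (intro exI[of _ ?O] conjI O ne x x[unfolded True]) (rule subset_trans[OF Diff_subset], simp)+
  qed
  then obtain U V where UV: "openin X U" "openin X V" "U \<subseteq> source s" "V \<subseteq> source t" "x \<in> U" "y \<in> V"
    and ne: "\<And>z. z \<in> U \<Longrightarrow> z \<in> V \<Longrightarrow> germ \<theta> s z \<noteq> germ \<theta> t z"
    by blast
  have "germ \<theta> s a \<noteq> germ \<theta> t b" if "a \<in> U" "b \<in> V" for a b
    using germ_eq_iff[of a s b t] UV(3,4) ne that by blast
  then have "disjnt (germ \<theta> s ` U) (germ \<theta> t ` V)"
    by (auto simp: disjnt_iff)
  then show "\<exists>U V. openin (transformation_groupoid X \<theta>) U \<and>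
      openin (transformation_groupoid X \<theta>) V \<and> g \<in> U \<and> h \<in> V \<and> disjnt U V"
    using openin_germ_image UV g(2) h(2) by blast
qed

text \<open>The hypothesis gives closedness only inside the domain of \<open>s\<^sup>*t\<close>, which may be smaller than
  \<open>X\<^bsub>s\<^sup>*s\<^esub> \<inter> X\<^bsub>t\<^sup>*t\<^esub>\<close>. The set where \<open>\<theta>\<^sub>s\<close> and \<open>\<theta>\<^sub>t\<close> agree lies in that domain and is closed in this
  intersection, so closedness passes to the larger set.\<close>

lemma closedin_common_source_of_idems_below:
  assumes X: "Hausdorff_space X"
    and closed: "closedin (subtopology X (source (star s * t)))
      (\<Union>e\<in>idems \<inter> down (star s * t). fixed_set \<theta> e)"
  shows "closedin (subtopology X (source s \<inter> source t)) (common_source s t)"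
proof -
  let ?D = "source s \<inter> source t"
  let ?A = "\<Union>e\<in>idems \<inter> down (star s * t). fixed_set \<theta> e"
  let ?C = "{x \<in> ?D. \<theta> s x = \<theta> t x}"
  have top: "topspace (subtopology X ?D) = ?D"
    using source_subset_topspace[of s] by (intro topspace_subtopology_subset) blast
  have cont: "continuous_map (subtopology X (source r)) X (\<lambda>x. the (\<theta> r x))" for r
    using continuous[of r] by (rule continuous_map_into_fulltopology)
  have "closedin (subtopology X ?D) {x \<in> topspace (subtopology X ?D). the (\<theta> s x) = the (\<theta> t x)}"
    by (intro closedin_continuous_maps_eq[OF X]
        continuous_map_from_subtopology_mono[OF cont]) auto
  moreover have "{x \<in> ?D. the (\<theta> s x) = the (\<theta> t x)} = ?C"
    by (auto simp only: source_iff option.sel)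
  ultimately have "closedin (subtopology X ?D) ?C" by (simp only: top)
  then obtain L where L: "closedin X L" "?C = L \<inter> ?D" unfolding closedin_subtopology by blast
  obtain K where K: "closedin X K" "?A = K \<inter> source (star s * t)"
    using closed unfolding closedin_subtopology by blast
  have "?C \<subseteq> source (star s * t)"
    using source_star_mult_of_eq by blast
  then have "?C \<inter> ?A = (K \<inter> L) \<inter> ?D"
    using K(2) L(2) by blast
  then show ?thesis
    unfolding common_source_eq_idems_below closedin_subtopology
    using closedin_Int[OF K(1) L(1)] by blast
qed

lemma closedin_idems_below:
  assumes "closedin (subtopology X (source s \<inter> source (star s * s)))
    (common_source s (star s * s))"
  shows "closedin (subtopology X (source s)) (\<Union>e\<in>idems \<inter> down s. fixed_set \<theta> e)"
  using assms unfolding idems_below_eq_common_source by (simp add: source_star_mult)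

section \<open>Compact domains\<close>

lemma closedin_common_source_iff_finite:
  assumes X: "Hausdorff_space X" and comp: "\<And>e. e \<in> idems \<Longrightarrow> compactin X (fixed_set \<theta> e)"
  shows "closedin (subtopology X (source s \<inter> source t)) (common_source s t) \<longleftrightarrow>
    (\<exists>F. finite F \<and> F \<subseteq> down s \<inter> down t \<and> (\<Union>v\<in>F. source v) = common_source s t)"
proof
  assume "closedin (subtopology X (source s \<inter> source t)) (common_source s t)"
  moreover have "compactin X (source s \<inter> source t)"
    by (intro closed_Int_compactin compactin_imp_closedin X comp star_mult_idem)
  ultimately have "compactin X (common_source s t)"
    using closedin_compact_space compactin_subspace compactin_subtopology by metis
  then obtain \<F> where \<F>: "finite \<F>" "\<F> \<subseteq> source ` (down s \<inter> down t)" "common_source s t \<subseteq> \<Union>\<F>"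
    using compactinD[of X "common_source s t" "source ` (down s \<inter> down t)"] openin_source by blast
  then obtain F where F: "F \<subseteq> down s \<inter> down t" "finite F" "\<F> = source ` F"
    by (meson finite_subset_image)
  then have "(\<Union>v\<in>F. source v) = common_source s t" using \<F>(3) by blast
  with F show "\<exists>F. finite F \<and> F \<subseteq> down s \<inter> down t \<and> (\<Union>v\<in>F. source v) = common_source s t"
    by blast
next
  assume "\<exists>F. finite F \<and> F \<subseteq> down s \<inter> down t \<and> (\<Union>v\<in>F. source v) = common_source s t"
  then obtain F where F: "finite F" "(\<Union>v\<in>F. source v) = common_source s t" by blast
  have "closedin X (\<Union>v\<in>F. source v)"
    using F(1) by (intro closedin_Union) (auto intro!: compactin_imp_closedin X comp star_mult_idem)
  then show "closedin (subtopology X (source s \<inter> source t)) (common_source s t)"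
    unfolding F(2) using common_source_subset by (rule closedin_subset_topspace)
qed

end

theorem proposition3p1p2:
  fixes X :: "'x topology" and \<theta> :: "'s::inverse_semigroup \<Rightarrow> 'x \<rightharpoonup> 'x"
  assumes "locally_compact_space X" and "Hausdorff_space X"
    and "inverse_semigroup_action X \<theta>"
  shows "(Hausdorff_space (transformation_groupoid X \<theta>) \<longleftrightarrow>
            (\<forall>s t. closedin (subtopology X (fixed_set \<theta> (star s * s) \<inter> fixed_set \<theta> (star t * t)))
              (\<Union>u\<in>down s \<inter> down t. fixed_set \<theta> (star u * u))))
       \<and> ((\<forall>s t. closedin (subtopology X (fixed_set \<theta> (star s * s) \<inter> fixed_set \<theta> (star t * t)))
              (\<Union>u\<in>down s \<inter> down t. fixed_set \<theta> (star u * u))) \<longleftrightarrow>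
          (\<forall>s. closedin (subtopology X (fixed_set \<theta> (star s * s))) (\<Union>e\<in>idems \<inter> down s. fixed_set \<theta> e)))
       \<and> ((\<forall>e\<in>idems. compactin X (fixed_set \<theta> e)) \<longrightarrow>
          (Hausdorff_space (transformation_groupoid X \<theta>) \<longleftrightarrow>
            (\<forall>s t. \<exists>F. finite F \<and> F \<subseteq> down s \<inter> down t \<and>
              (\<Union>v\<in>F. fixed_set \<theta> (star v * v)) = (\<Union>u\<in>down s \<inter> down t. fixed_set \<theta> (star u * u)))))"
proof -
  interpret inverse_semigroup_action X \<theta> by fact
  let ?ii = "\<forall>s t. closedin (subtopology X (source s \<inter> source t)) (common_source s t)"
  have i_ii: "Hausdorff_space (transformation_groupoid X \<theta>) \<longleftrightarrow> ?ii"
    using closedin_common_source Hausdorff_space_transformation_groupoid[OF assms(2)] by blast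
  moreover have "?ii \<longleftrightarrow>
      (\<forall>s. closedin (subtopology X (source s)) (\<Union>e\<in>idems \<inter> down s. fixed_set \<theta> e))"
    using closedin_idems_below closedin_common_source_of_idems_below[OF assms(2)] by blast
  moreover have "?ii \<longleftrightarrow>
      (\<forall>s t. \<exists>F. finite F \<and> F \<subseteq> down s \<inter> down t \<and> (\<Union>v\<in>F. source v) = common_source s t)"
    if "\<forall>e\<in>idems. compactin X (fixed_set \<theta> e)"
    using closedin_common_source_iff_finite[OF assms(2)] that by simp
  ultimately show ?thesis by simp
qed

end
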